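(* Let $\mu$ be a finitely-supported probability measure on $\mathrm{Mat}_2(\mathbb{R})$. Then \[ T(\mu) \leq 8\, \delta(\mu). \]
   Context: $\mathrm{Mat}_2(\mathbb{R})$ denotes the set of $2\times 2$ real matrices and $\mathrm{supp}(\mu)$ the support of $\mu$. Define \[ T(\mu) = \sum_{X, Y \in \mathrm{supp}(\mu)} \mu(X)\mu(Y)\,\mathbb{1}_{XY=YX}. \] For a finite non-empty set $\mathcal{S}\subset \mathrm{Mat}_2(\mathbb{R})$, $\dim(\mathcal{S})$ denotes the dimension of the real vector space spanned by the elements of $\mathcal{S}$. Define \[ \delta(\mu) = \max_{\mathcal{S}' \subseteq \mathrm{supp}(\mu),\ \dim(\mathcal{S}')\leq 2} \mu(\mathcal{S}'). \] *)

theory Defs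
  imports "HOL-Probability.Probability"
begin

definition commuting_mass :: "(real^2^2) pmf \<Rightarrow> real" where
  "commuting_mass \<mu> =
     (\<Sum>X\<in>set_pmf \<mu>. \<Sum>Y\<in>set_pmf \<mu>.
        pmf \<mu> X * pmf \<mu> Y * of_bool (X ** Y = Y ** X))"

text \<open>For finitely supported \<open>\<mu>\<close> the set below is finite, and it is non-empty since it contains
  the masses of the singletons of the support, so \<open>Max\<close> is a genuine maximum. Here \<open>dim S\<close> is the
  real dimension of the span of \<open>S\<close> in the four-dimensional space of matrices.\<close>

definition planar_mass :: "(real^2^2) pmf \<Rightarrow> real" where
  "planar_mass \<mu> =
     Max {measure_pmf.prob \<mu> S | S. S \<subseteq> set_pmf \<mu> \<and> S \<noteq> {} \<and> dim S \<le> 2}"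

end

theory Submission
  imports Defs
begin

text \<open>The centralizer of a non-scalar \<open>2 \<times> 2\<close> matrix \<open>X\<close> is the plane spanned by the identity
  and \<open>X\<close>, so a non-scalar \<open>X\<close> commutes with a subset of the support of mass at most
  \<open>\<delta>(\<mu>)\<close>. The scalar matrices lie on a line and have total mass at most \<open>\<delta>(\<mu>)\<close> as well.
  Splitting the sum over \<open>X\<close> accordingly gives even \<open>T(\<mu>) \<le> 2 \<delta>(\<mu>)\<close>.\<close>

lemma matrix_2_eq_iff:
  fixes A B :: "'a^2^2"
  shows "A = B \<longleftrightarrow> A$1$1 = B$1$1 \<and> A$1$2 = B$1$2 \<and> A$2$1 = B$2$1 \<and> A$2$2 = B$2$2"
  by (auto simp: vec_eq_iff forall_2)

text \<open>The triple of off-diagonal entries and diagonal difference determines a matrix up to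
  adding a scalar matrix. The three equations say that all 2 by 2 minors of the triples of
  \<open>X\<close> and \<open>Y\<close> vanish, that is, the triples are linearly dependent.\<close>

lemma commute_2_iff:
  fixes X Y :: "real^2^2"
  shows "X ** Y = Y ** X \<longleftrightarrow>
    X$1$2 * Y$2$1 = Y$1$2 * X$2$1 \<and>
    X$1$2 * (Y$1$1 - Y$2$2) = Y$1$2 * (X$1$1 - X$2$2) \<and>
    X$2$1 * (Y$1$1 - Y$2$2) = Y$2$1 * (X$1$1 - X$2$2)"
  by (auto simp: matrix_2_eq_iff matrix_matrix_mult_def sum_2 algebra_simps)

lemma scalar_in_span:
  fixes X :: "real^2^2"
  assumes "X$1$2 = 0" "X$2$1 = 0" "X$1$1 = X$2$2"
  shows "X \<in> span {mat 1}"
proof -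
  have "X = X$1$1 *\<^sub>R mat 1"
    using assms by (simp add: matrix_2_eq_iff mat_def)
  then show ?thesis
    by (metis span_base span_scale singletonI)
qed

text \<open>Since \<open>X\<close> is not scalar, its triple from \<open>commute_2_iff\<close> is
  nonzero, so the triple of \<open>Y\<close> is a multiple of it by some \<open>b\<close>. Then
  \<open>Y - b X\<close> is scalar.\<close>

lemma commute_in_span:
  fixes X Y :: "real^2^2"
  assumes "X \<notin> span {mat 1}" and comm: "X ** Y = Y ** X"
  shows "Y \<in> span {mat 1, X}"
proof -
  have "\<exists>b. Y$1$2 = b * X$1$2 \<and> Y$2$1 = b * X$2$1 \<and>
      Y$1$1 - Y$2$2 = b * (X$1$1 - X$2$2)"
  proof -
    \<comment> \<open>Any nonzero coordinate of the triple of \<open>X\<close> fixes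
      \<open>b\<close> as a ratio; the minors involving it give the other two coordinates.\<close>
    consider "X$1$2 \<noteq> 0" | "X$2$1 \<noteq> 0" | "X$1$1 - X$2$2 \<noteq> 0"
      using scalar_in_span assms(1) by fastforce
    then show ?thesis
    proof cases
      case 1
      then show ?thesis
        using comm unfolding commute_2_iff
        by (intro exI[of _ "Y$1$2 / X$1$2"]) (simp add: field_simps)
    next
      case 2
      then show ?thesis
        using comm unfolding commute_2_iff
        by (intro exI[of _ "Y$2$1 / X$2$1"]) (simp add: field_simps)
    next
      case 3
      then show ?thesis
        using comm unfolding commute_2_iff
        by (intro exI[of _ "(Y$1$1 - Y$2$2) / (X$1$1 - X$2$2)"]) (simp add: nonzero_eq_divide_eq mult.commute)
    qed
  qed
  then obtain b where b: "Y$1$2 = b * X$1$2" "Y$2$1 = b * X$2$1"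
      "Y$1$1 - Y$2$2 = b * (X$1$1 - X$2$2)"
    by blast
  \<comment> \<open>The scalar matrix \<open>Y - b X\<close> is read off from its upper left
    entry.\<close>
  have "Y = (Y$1$1 - b * X$1$1) *\<^sub>R mat 1 + b *\<^sub>R X"
    using b by (simp add: matrix_2_eq_iff mat_def algebra_simps)
  moreover have "\<dots> \<in> span {mat 1, X}"
    by (intro span_add span_scale span_base) auto
  ultimately show ?thesis
    by simp
qed

lemma prob_le_planar_mass:
  assumes fin: "finite (set_pmf \<mu>)" and S: "S \<subseteq> set_pmf \<mu>" "dim S \<le> 2"
  shows "measure_pmf.prob \<mu> S \<le> planar_mass \<mu>"
proof -
  define M where
    "M = {measure_pmf.prob \<mu> S | S. S \<subseteq> set_pmf \<mu> \<and> S \<noteq> {} \<and> dim S \<le> 2}"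
  have "M \<subseteq> measure_pmf.prob \<mu> ` Pow (set_pmf \<mu>)"
    unfolding M_def by blast
  then have finM: "finite M"
    using fin by (meson finite_Pow_iff finite_imageI finite_subset)
  have le: "measure_pmf.prob \<mu> A \<le> planar_mass \<mu>"
    if "A \<subseteq> set_pmf \<mu>" "A \<noteq> {}" "dim A \<le> 2" for A
  proof -
    have "measure_pmf.prob \<mu> A \<in> M"
      using that unfolding M_def by blast
    then show ?thesis
      unfolding planar_mass_def M_def[symmetric] using finM by (rule Max_ge[rotated])
  qed
  show ?thesis
  proof (cases "S = {}")
    case True
    \<comment> \<open>The maximum ranges over nonempty sets only, so the mass 0 of the empty set is
      compared with that of a singleton.\<close>
    obtain X where "X \<in> set_pmf \<mu>"
      using set_pmf_not_empty[of \<mu>] by blast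
    moreover have "dim {X} \<le> 2"
      using dim_le_card[of "{X}" "{X}"] by (simp add: span_superset)
    ultimately have "measure_pmf.prob \<mu> {X} \<le> planar_mass \<mu>"
      by (intro le) auto
    then show ?thesis
      using True measure_nonneg[of "measure_pmf \<mu>" "{X}"] by (metis measure_empty order_trans)
  qed (use le S in blast)
qed

text \<open>Collecting the sum over \<open>Y\<close> first lets the centralizer of each
  \<open>X\<close> be bounded separately.\<close>

lemma commuting_mass_eq:
  assumes "finite (set_pmf \<mu>)"
  shows "commuting_mass \<mu> =
    (\<Sum>X\<in>set_pmf \<mu>. pmf \<mu> X * measure_pmf.prob \<mu> {Y \<in> set_pmf \<mu>. X ** Y = Y ** X})"
  unfolding commuting_mass_def
proof (rule sum.cong[OF refl])
  fix X
  have "measure_pmf.prob \<mu> {Y \<in> set_pmf \<mu>. X ** Y = Y ** X} =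
      (\<Sum>Y\<in>set_pmf \<mu>. pmf \<mu> Y * of_bool (X ** Y = Y ** X))"
    using assms by (simp add: measure_measure_pmf_finite of_bool_def if_distrib sum.inter_filter
        cong: if_cong)
  then show "(\<Sum>Y\<in>set_pmf \<mu>. pmf \<mu> X * pmf \<mu> Y * of_bool (X ** Y = Y ** X)) =
      pmf \<mu> X * measure_pmf.prob \<mu> {Y \<in> set_pmf \<mu>. X ** Y = Y ** X}"
    by (simp add: sum_distrib_left mult.assoc)
qed

lemma commuting_mass_le_2_planar_mass:
  assumes fin: "finite (set_pmf \<mu>)"
  shows "commuting_mass \<mu> \<le> 2 * planar_mass \<mu>"
proof -
  let ?C = "\<lambda>X. {Y \<in> set_pmf \<mu>. X ** Y = Y ** X}"
  define L where "L = set_pmf \<mu> \<inter> span {mat 1}"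
  have finL: "finite L"
    using fin by (simp add: L_def)
  have "dim L \<le> card {mat 1 :: real^2^2}"
    by (intro dim_le_card) (auto simp: L_def)
  then have L: "measure_pmf.prob \<mu> L \<le> planar_mass \<mu>"
    by (intro prob_le_planar_mass fin) (auto simp: L_def)
  have C: "measure_pmf.prob \<mu> (?C X) \<le> planar_mass \<mu>" if "X \<in> set_pmf \<mu> - L" for X
  proof (intro prob_le_planar_mass fin)
    have "?C X \<subseteq> span {mat 1, X}"
      using that commute_in_span by (auto simp: L_def)
    then have "dim (?C X) \<le> card {mat 1, X}"
      by (intro dim_le_card) auto
    also have "\<dots> \<le> 2"
      by (simp add: card_insert_if)
    finally show "dim (?C X) \<le> 2" .
  qed auto
  have nonneg: "0 \<le> planar_mass \<mu>"
    using L measure_nonneg order_trans by blast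
  have "commuting_mass \<mu> = (\<Sum>X\<in>set_pmf \<mu> - L. pmf \<mu> X * measure_pmf.prob \<mu> (?C X))
      + (\<Sum>X\<in>L. pmf \<mu> X * measure_pmf.prob \<mu> (?C X))"
    unfolding commuting_mass_eq[OF fin] by (rule sum.subset_diff) (auto simp: L_def fin)
  \<comment> \<open>A scalar \<open>X\<close> commutes with everything, so only the trivial bound 1
    is used on \<open>L\<close>; the gain there comes from the small mass of \<open>L\<close>
    itself.\<close>
  also have "\<dots> \<le> (\<Sum>X\<in>set_pmf \<mu> - L. pmf \<mu> X * planar_mass \<mu>) + (\<Sum>X\<in>L. pmf \<mu> X * 1)"
    by (intro add_mono sum_mono mult_left_mono C) auto
  also have "\<dots> = measure_pmf.prob \<mu> (set_pmf \<mu> - L) * planar_mass \<mu> + measure_pmf.prob \<mu> L"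
    using fin finL by (simp add: measure_measure_pmf_finite sum_distrib_right)
  also have "\<dots> \<le> 1 * planar_mass \<mu> + planar_mass \<mu>"
    by (intro add_mono mult_right_mono L nonneg) auto
  finally show ?thesis
    by simp
qed

theorem theorem1p1:
  fixes \<mu> :: "(real^2^2) pmf"
  assumes "finite (set_pmf \<mu>)"
  shows "commuting_mass \<mu> \<le> 8 * planar_mass \<mu>"
proof -
  \<comment> \<open>Nonnegativity allows the constant 2 to be weakened to 8.\<close>
  have "0 \<le> planar_mass \<mu>"
    using prob_le_planar_mass[OF assms, of "{}"] by simp
  then show ?thesis
    using commuting_mass_le_2_planar_mass[OF assms] by linarith
qed

end
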